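(* Let $\mathscr{B}\subseteq\mathbb{R}^2$ be a set of points $(y,z)$ with $z>0$ and let $\mathscr{D}=\{y/z:(y,z)\in\mathscr{B}\}$. Let $\Omega\subseteq\{0,1\}^\ell$ be nonempty, let $b_0<b_1<\dots<b_{|\Omega|}$ be breakpoints with $\mathscr{D}\subseteq[b_0,b_{|\Omega|})$, and let $\phi$ be a real-valued increasing function on a subset of $\mathbb{R}$ containing $\mathscr{D}$ and all breakpoints, with $\psi(y,z)=\phi(y/z)$. For each $\boldsymbol\omega\in\Omega$ let $\mathscr{B}_{\boldsymbol\omega}\subset\mathbb{R}\times\mathbb{R}_{>0}$ be a bounded polyhedron, with the $\mathscr{B}_{\boldsymbol\omega}$ having pairwise disjoint interiors. If $$\mathscr{B}\subseteq\bigcup_{\boldsymbol\omega\in\Omega}\mathscr{B}_{\boldsymbol\omega}\qquad\text{and}\qquad\left\{\frac yz:(y,z)\in\operatorname{ext}(\mathscr{B}_{\boldsymbol\omega})\right\}=\left\{b_{\mathcal{Q}(\boldsymbol\omega)},\,b_{\mathcal{Q}(\boldsymbol\omega)+1}\right\}\quad\text{for every }\boldsymbol\omega\in\Omega,$$ then $$\operatorname{proj}_{\left(r=\frac yz,\,f\right)}\left(\operatorname{logE}_V(\psi)\right)\subseteq\operatorname{step}_{\{b_k\}}(\phi).$$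
   Context: Gray code: for $\boldsymbol\delta\in\{0,1\}^\ell$, $\mathcal{Q}(\boldsymbol\delta)=\sum_{k=1}^\ell2^{\ell-k}\left[\left(\sum_{t=1}^k\delta_t\right)\bmod2\right]\in\{0,\dots,2^\ell-1\}$; this is a bijection sending a reflective Gray code to the integer it represents. $\operatorname{ext}(P)$ is the set of extreme points of $P$ and $V=\bigcup_{\boldsymbol\omega\in\Omega}\operatorname{ext}(\mathscr{B}_{\boldsymbol\omega})$. For $p\in\{0,1\}$ and $k\in\{1,\dots,\ell\}$, $V|^k_p$ is the set of $\mathbf{v}\in V$ such that $\omega_k=p$ for every $\boldsymbol\omega\in\Omega$ with $\mathbf{v}\in\operatorname{ext}(\mathscr{B}_{\boldsymbol\omega})$. $\operatorname{logE}_V(\psi)$ is the set of $(y,z,f,\boldsymbol\delta,\boldsymbol\lambda)\in\mathscr{B}\times\mathbb{R}\times\Omega\times[0,1]^{V}$ such that $$f=\sum_{\mathbf v\in V}\lambda_{\mathbf v}\psi(\mathbf v),\quad(y,z)=\sum_{\mathbf v\in V}\lambda_{\mathbf v}\mathbf v,\quad1=\sum_{\mathbf v\in V}\lambda_{\mathbf v},$$ $$1-\delta_k\ge\sum_{\mathbf v\in V|^k_0}\lambda_{\mathbf v},\quad\delta_k\ge\sum_{\mathbf v\in V|^k_1}\lambda_{\mathbf v}\quad\forall k\in\{1,\dots,\ell\}.$$ $\operatorname{step}_{\{b_k\}}(\phi)=\{(r,f)\in\mathscr{D}\times\mathbb{R}:\text{for all }k\in\{1,\dots,|\Omega|\},\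 \text{if }r\in[b_{k-1},b_k)\text{ then }f\le\phi(b_k)\}$. $\operatorname{proj}_{(r=y/z,f)}(S)=\{(y/z,f):(y,z,f,\boldsymbol\delta,\boldsymbol\lambda)\in S\text{ for some }\boldsymbol\delta,\boldsymbol\lambda\}$. *)

theory Defs
  imports "HOL-Analysis.Analysis"
begin

text \<open>Vectors in \<open>{0,1}^l\<close> are functions on the index set \<open>{1..l}\<close>. They are taken to be extensional,
  so that distinct functions are distinct vectors and \<open>card\<close> counts vectors.\<close>

definition bin_vecs :: "nat \<Rightarrow> (nat \<Rightarrow> nat) set" where
  "bin_vecs l = {1..l} \<rightarrow>\<^sub>E {0, 1}"

definition gray_num :: "nat \<Rightarrow> (nat \<Rightarrow> nat) \<Rightarrow> nat" where
  "gray_num l \<delta> = (\<Sum>k=1..l. 2 ^ (l - k) * ((\<Sum>t=1..k. \<delta> t) mod 2))"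

definition ext_pts :: "'a::real_vector set \<Rightarrow> 'a set" where
  "ext_pts P = {v. v extreme_point_of P}"

definition ratios :: "(real \<times> real) set \<Rightarrow> real set" where
  "ratios S = {y / z | y z. (y, z) \<in> S}"

definition all_verts :: "'w set \<Rightarrow> ('w \<Rightarrow> (real \<times> real) set) \<Rightarrow> (real \<times> real) set" where
  "all_verts \<Omega> Bw = (\<Union>\<omega>\<in>\<Omega>. ext_pts (Bw \<omega>))"

definition verts_bit ::
  "(nat \<Rightarrow> nat) set \<Rightarrow> ((nat \<Rightarrow> nat) \<Rightarrow> (real \<times> real) set) \<Rightarrow> nat \<Rightarrow> nat \<Rightarrow> (real \<times> real) set" where
  "verts_bit \<Omega> Bw k p =
     {v \<in> all_verts \<Omega> Bw. \<forall>\<omega>\<in>\<Omega>. v \<in> ext_pts (Bw \<omega>) \<longrightarrow> \<omega> k = p}"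

definition logE ::
  "nat \<Rightarrow> (real \<times> real) set \<Rightarrow> (nat \<Rightarrow> nat) set \<Rightarrow> ((nat \<Rightarrow> nat) \<Rightarrow> (real \<times> real) set) \<Rightarrow>
   (real \<times> real \<Rightarrow> real) \<Rightarrow>
   (real \<times> real \<times> real \<times> (nat \<Rightarrow> nat) \<times> (real \<times> real \<Rightarrow> real)) set" where
  "logE l B \<Omega> Bw \<psi> =
     {(y, z, f, \<delta>, lam).
        (y, z) \<in> B \<and> \<delta> \<in> \<Omega> \<and> lam \<in> all_verts \<Omega> Bw \<rightarrow>\<^sub>E {0..1} \<and>
        f = (\<Sum>v\<in>all_verts \<Omega> Bw. lam v * \<psi> v) \<and>
        (y, z) = (\<Sum>v\<in>all_verts \<Omega> Bw. lam v *\<^sub>R v) \<and>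
        1 = (\<Sum>v\<in>all_verts \<Omega> Bw. lam v) \<and>
        (\<forall>k\<in>{1..l}.
           1 - real (\<delta> k) \<ge> (\<Sum>v\<in>verts_bit \<Omega> Bw k 0. lam v) \<and>
           real (\<delta> k) \<ge> (\<Sum>v\<in>verts_bit \<Omega> Bw k 1. lam v))}"

definition step_set ::
  "real set \<Rightarrow> nat \<Rightarrow> (nat \<Rightarrow> real) \<Rightarrow> (real \<Rightarrow> real) \<Rightarrow> (real \<times> real) set" where
  "step_set D n b \<phi> =
     {(r, f). r \<in> D \<and> (\<forall>k\<in>{1..n}. r \<in> {b (k - 1)..<b k} \<longrightarrow> f \<le> \<phi> (b k))}"

definition proj_ratio ::
  "(real \<times> real \<times> real \<times> 'd \<times> 'l) set \<Rightarrow> (real \<times> real) set" where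
  "proj_ratio S = {(y / z, f) | y z f. \<exists>\<delta> lam. (y, z, f, \<delta>, lam) \<in> S}"

end

theory Submission
  imports Defs
begin

text \<open>
  The vertices of a cell \<open>Bw \<omega>\<close> have ratio \<open>b q\<close> or \<open>b (q + 1)\<close>, where \<open>q\<close> is the Gray number of
  \<open>\<omega>\<close>, so a vertex of ratio \<open>b j\<close> is shared at most by the cells with Gray numbers \<open>j - 1\<close> and \<open>j\<close>.
  The bit inequalities with binary vector \<open>\<delta>\<close> force \<open>\<lambda>\<close> to vanish on every vertex \<open>v\<close> which, for some
  bit, lies only in cells that disagree with \<open>\<delta>\<close> in that bit. For a vertex in the support of
  \<open>\<lambda>\<close>, therefore, each single bit of \<open>\<delta>\<close> occurs in some cell at \<open>v\<close>. In general such bits could be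
  mixed from different cells; here they cannot, because the codes of the two candidate cells
  are consecutive in the Gray code and differ in one position only. So \<open>\<delta>\<close> is itself one of the
  two candidates (\<open>bitwise_choice_gray\<close>), which means that the vertices in the support have ratio
  \<open>b q\<close> or \<open>b (q + 1)\<close> with \<open>q\<close> the Gray number of \<open>\<delta>\<close>.

  Now \<open>y / z\<close> is an average of the ratios of these vertices (with weights \<open>\<lambda> v\<close> times the
  \<open>z\<close>-coordinate of \<open>v\<close>), hence at least \<open>b q\<close>, while \<open>f\<close> is an average of values of \<open>\<phi>\<close> at \<open>b q\<close> and
  \<open>b (q + 1)\<close>, hence at most \<open>\<phi> (b (q + 1))\<close>. If \<open>y / z < b k\<close>, then \<open>q + 1 \<le> k\<close> and monotonicity
  of \<open>\<phi>\<close> gives \<open>f \<le> \<phi> (b k)\<close>.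
\<close>

section \<open>Consecutive Gray codes\<close>

text \<open>Appending a bit doubles the number and adds the new prefix parity; the old prefix parity
  is the last binary digit of the old number. With this recursion, parities of sums over prefixes
  need not be mentioned again.\<close>

lemma gray_num_Suc:
  "gray_num (Suc l) \<delta> = 2 * gray_num l \<delta> + (gray_num l \<delta> + \<delta> (Suc l)) mod 2"
proof -
  have step: "gray_num (Suc m) \<delta> = 2 * gray_num m \<delta> + (\<Sum>t=1..Suc m. \<delta> t) mod 2" for m
  proof -
    have "(\<Sum>k=1..m. 2 ^ (Suc m - k) * ((\<Sum>t=1..k. \<delta> t) mod 2)) = 2 * gray_num m \<delta>"
      unfolding gray_num_def sum_distrib_left
      by (rule sum.cong) (auto simp: Suc_diff_le)
    then show ?thesis
      by (simp add: gray_num_def)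
  qed
  have "gray_num l \<delta> mod 2 = (\<Sum>t=1..l. \<delta> t) mod 2"
  proof (cases l)
    case 0
    then show ?thesis by (simp add: gray_num_def)
  next
    case (Suc m)
    then show ?thesis by (simp only: step) simp
  qed
  then have "(\<Sum>t=1..Suc l. \<delta> t) mod 2 = (gray_num l \<delta> + \<delta> (Suc l)) mod 2"
    by (simp del: One_nat_def) (metis mod_add_left_eq)
  with step[of l] show ?thesis by simp
qed

lemma gray_num_eqD:
  assumes "gray_num l \<alpha> = gray_num l \<beta>"
    and "\<And>k. k \<in> {1..l} \<Longrightarrow> \<alpha> k < 2" "\<And>k. k \<in> {1..l} \<Longrightarrow> \<beta> k < 2"
    and "k \<in> {1..l}"
  shows "\<alpha> k = \<beta> k"
  using assms
proof (induction l)
  case 0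
  then show ?case by simp
next
  case (Suc l)
  have last: "\<alpha> (Suc l) < 2" "\<beta> (Suc l) < 2"
    using Suc.prems(2,3) by auto
  have "a = c \<and> x = y"
    if "2 * a + (a + x) mod 2 = 2 * c + (c + y) mod 2" "x < 2" "y < 2" for a c x y :: nat
  proof -
    have "a = c"
      using that(1) mod_less_divisor[of 2 "a + x"] mod_less_divisor[of 2 "c + y"] by linarith
    then show ?thesis
      using that by (auto simp: less_2_cases_iff mod_Suc split: if_splits)
  qed
  then have "gray_num l \<alpha> = gray_num l \<beta> \<and> \<alpha> (Suc l) = \<beta> (Suc l)"
    using Suc.prems(1) last unfolding gray_num_Suc by blast
  then show ?case
    using Suc.IH Suc.prems(2-4) by (cases "k = Suc l") auto
qed

text \<open>Either the last binary digit goes from 0 to 1, all earlier digits and hence all earlier bits being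
  equal, or there is a carry. With a carry the last digit changes, but so does the digit before
  it, and the last bit of the code, which is the sum of these two digits modulo 2, stays the same.\<close>

lemma gray_num_consecutive:
  assumes "gray_num l \<beta> = gray_num l \<alpha> + 1"
    and "\<And>k. k \<in> {1..l} \<Longrightarrow> \<alpha> k < 2" "\<And>k. k \<in> {1..l} \<Longrightarrow> \<beta> k < 2"
  shows "\<exists>c. \<forall>k\<in>{1..l} - {c}. \<alpha> k = \<beta> k"
  using assms
proof (induction l)
  case 0
  then show ?case by simp
next
  case (Suc l)
  have last: "\<alpha> (Suc l) < 2" "\<beta> (Suc l) < 2"
    using Suc.prems(2,3) by auto
  have "c = a \<or> c = a + 1 \<and> x = y"
    if "2 * c + (c + y) mod 2 = 2 * a + (a + x) mod 2 + 1" "x < 2" "y < 2" for a c x y :: nat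
  proof -
    have "c = a \<or> c = a + 1"
      using that(1) mod_less_divisor[of 2 "a + x"] mod_less_divisor[of 2 "c + y"] by linarith
    then show ?thesis
      using that by (auto simp: less_2_cases_iff mod_Suc split: if_splits)
  qed
  then have "gray_num l \<beta> = gray_num l \<alpha> \<or>
      gray_num l \<beta> = gray_num l \<alpha> + 1 \<and> \<alpha> (Suc l) = \<beta> (Suc l)"
    using Suc.prems(1) last unfolding gray_num_Suc by blast
  then show ?case
  proof
    assume "gray_num l \<beta> = gray_num l \<alpha>"
    then have "\<forall>k\<in>{1..l}. \<alpha> k = \<beta> k"
      using gray_num_eqD[of l \<alpha> \<beta>] Suc.prems(2,3) by auto
    then have "\<forall>k\<in>{1..Suc l} - {Suc l}. \<alpha> k = \<beta> k"
      by auto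
    then show ?thesis ..
  next
    assume carry: "gray_num l \<beta> = gray_num l \<alpha> + 1 \<and> \<alpha> (Suc l) = \<beta> (Suc l)"
    then obtain c where "\<forall>k\<in>{1..l} - {c}. \<alpha> k = \<beta> k"
      using Suc.IH Suc.prems(2,3) by auto
    with carry have "\<forall>k\<in>{1..Suc l} - {c}. \<alpha> k = \<beta> k"
      by (auto simp: le_Suc_eq)
    then show ?thesis ..
  qed
qed

lemma bin_vecs_less_2: "\<omega> \<in> bin_vecs l \<Longrightarrow> k \<in> {1..l} \<Longrightarrow> \<omega> k < 2"
  unfolding bin_vecs_def by (drule (1) PiE_mem) auto

lemma inj_on_gray_num: "inj_on (gray_num l) (bin_vecs l)"
proof (rule inj_onI)
  fix \<alpha> \<beta> assume *: "\<alpha> \<in> bin_vecs l" "\<beta> \<in> bin_vecs l" "gray_num l \<alpha> = gray_num l \<beta>"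
  then have "\<alpha> k = \<beta> k" if "k \<in> {1..l}" for k
    using gray_num_eqD[of l \<alpha> \<beta> k] bin_vecs_less_2 that by blast
  with * show "\<alpha> = \<beta>"
    unfolding bin_vecs_def by (intro PiE_ext[of \<alpha> _ _ \<beta>]) auto
qed

text \<open>Two consecutive codes already exhaust both values of the one bit in which they differ, so every
  binary vector that agrees with one of them in each bit separately is one of them.\<close>

lemma bitwise_choice_gray:
  assumes W: "W \<subseteq> bin_vecs l" "W \<noteq> {}" "\<delta> \<in> bin_vecs l"
    and nums: "\<And>\<omega>. \<omega> \<in> W \<Longrightarrow> gray_num l \<omega> = j \<or> gray_num l \<omega> + 1 = j"
    and bits: "\<And>k. k \<in> {1..l} \<Longrightarrow> \<exists>\<omega>\<in>W. \<omega> k = \<delta> k"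
  shows "\<delta> \<in> W"
proof -
  have binary: "\<omega> k < 2" if "\<omega> \<in> insert \<delta> W" "k \<in> {1..l}" for \<omega> k
    using that W bin_vecs_less_2 by blast
  have eqI: "\<omega> = \<delta>" if "\<omega> \<in> W" "\<And>k. k \<in> {1..l} \<Longrightarrow> \<omega> k = \<delta> k" for \<omega>
    using PiE_ext[of \<omega> "{1..l}" "\<lambda>_. {0, 1}" \<delta>] that W(1,3) unfolding bin_vecs_def by blast
  show ?thesis
  proof (cases "\<exists>\<alpha>\<in>W. \<exists>\<beta>\<in>W. gray_num l \<beta> = gray_num l \<alpha> + 1")
    case True
    then obtain \<alpha> \<beta> where ab: "\<alpha> \<in> W" "\<beta> \<in> W" "gray_num l \<beta> = gray_num l \<alpha> + 1"
      by blast
    then obtain c where c: "\<forall>k\<in>{1..l} - {c}. \<alpha> k = \<beta> k"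
      using gray_num_consecutive[of l \<beta> \<alpha>] binary by blast
    have only: "\<omega> = \<alpha> \<or> \<omega> = \<beta>" if "\<omega> \<in> W" for \<omega>
    proof -
      have "gray_num l \<omega> = gray_num l \<alpha> \<or> gray_num l \<omega> = gray_num l \<beta>"
        using nums[OF that] nums[OF ab(1)] nums[OF ab(2)] ab(3) by linarith
      then show ?thesis
        using inj_onD[OF inj_on_gray_num] that ab(1,2) W(1) by blast
    qed
    have off: "\<alpha> k = \<delta> k \<and> \<beta> k = \<delta> k" if "k \<in> {1..l}" "k \<noteq> c" for k
      using bits[OF that(1)] only c that by fastforce
    have "c \<in> {1..l} \<Longrightarrow> \<alpha> c = \<delta> c \<or> \<beta> c = \<delta> c"
      using bits only by blast
    with off have "(\<forall>k\<in>{1..l}. \<alpha> k = \<delta> k) \<or> (\<forall>k\<in>{1..l}. \<beta> k = \<delta> k)"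
      by blast
    then show ?thesis
      using eqI ab(1,2) by blast
  next
    case False
    \<comment> \<open>All Gray numbers on \<open>W\<close> are then equal, so \<open>W\<close> is a singleton.\<close>
    obtain \<omega> where \<omega>: "\<omega> \<in> W" using W(2) by blast
    have "\<omega>' = \<omega>" if "\<omega>' \<in> W" for \<omega>'
    proof -
      have "gray_num l \<omega>' = gray_num l \<omega>"
        using False nums[OF that] nums[OF \<omega>] that \<omega> by fastforce
      then show ?thesis
        using inj_onD[OF inj_on_gray_num] that \<omega> W(1) by blast
    qed
    then have "\<omega> k = \<delta> k" if "k \<in> {1..l}" for k
      using bits[OF that] by blast
    then show ?thesis
      using eqI[OF \<omega>] \<omega> by simp
  qed
qed

section \<open>The support of a feasible weight vector\<close>

text \<open>Since \<open>\<delta> k\<close> is 0 or 1, one of the two inequalities for bit \<open>k\<close> bounds by 0 the total weight of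
  the vertices all of whose cells have the bit opposite to \<open>\<delta> k\<close>. As the weights are nonnegative,
  each of them is 0 there.\<close>

lemma support_shares_bits:
  assumes fin: "finite (all_verts \<Omega> Bw)"
    and nonneg: "\<And>v. v \<in> all_verts \<Omega> Bw \<Longrightarrow> 0 \<le> lam v"
    and zero: "1 - real (\<delta> k) \<ge> (\<Sum>v\<in>verts_bit \<Omega> Bw k 0. lam v)"
    and one: "real (\<delta> k) \<ge> (\<Sum>v\<in>verts_bit \<Omega> Bw k 1. lam v)"
    and binary: "\<And>\<omega>. \<omega> \<in> insert \<delta> \<Omega> \<Longrightarrow> \<omega> k < 2"
    and v: "v \<in> all_verts \<Omega> Bw" "lam v \<noteq> 0"
  shows "\<exists>\<omega>\<in>\<Omega>. v \<in> ext_pts (Bw \<omega>) \<and> \<omega> k = \<delta> k"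
proof (rule ccontr)
  assume no: "\<not> ?thesis"
  have flip: "\<omega> k = 1 - \<delta> k" if "\<omega> \<in> \<Omega>" "v \<in> ext_pts (Bw \<omega>)" for \<omega>
    using no that binary[of \<omega>] binary[of \<delta>] by fastforce
  then have mem: "v \<in> verts_bit \<Omega> Bw k (1 - \<delta> k)"
    using v(1) by (simp add: verts_bit_def)
  have sub: "verts_bit \<Omega> Bw k p \<subseteq> all_verts \<Omega> Bw" for p
    by (auto simp: verts_bit_def)
  have "(\<Sum>v\<in>verts_bit \<Omega> Bw k (1 - \<delta> k). lam v) \<le> 0"
    using zero one binary[of \<delta>] by (cases "\<delta> k = 0") (auto simp: less_2_cases_iff)
  moreover have "lam v \<le> (\<Sum>v\<in>verts_bit \<Omega> Bw k (1 - \<delta> k). lam v)"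
    using mem sub nonneg fin by (intro member_le_sum) (auto intro: finite_subset)
  ultimately show False
    using v nonneg[of v] by simp
qed

section \<open>The logarithmic extended formulation\<close>

theorem proposition10:
  fixes l :: nat
    and B :: "(real \<times> real) set"
    and \<Omega> :: "(nat \<Rightarrow> nat) set"
    and b :: "nat \<Rightarrow> real"
    and T :: "real set"
    and \<phi> :: "real \<Rightarrow> real"
    and \<psi> :: "real \<times> real \<Rightarrow> real"
    and Bw :: "(nat \<Rightarrow> nat) \<Rightarrow> (real \<times> real) set"
  assumes B_pos: "B \<subseteq> UNIV \<times> {0<..}"
    and Omega: "\<Omega> \<subseteq> bin_vecs l" "\<Omega> \<noteq> {}"
    and b_incr: "strict_mono_on {0..card \<Omega>} b"
    and D_range: "ratios B \<subseteq> {b 0..<b (card \<Omega>)}"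
    and T_sup: "ratios B \<subseteq> T" "b ` {0..card \<Omega>} \<subseteq> T"
    and phi_incr: "mono_on T \<phi>"
    and psi: "\<And>y z. z > 0 \<Longrightarrow> y / z \<in> T \<Longrightarrow> \<psi> (y, z) = \<phi> (y / z)"
    and Bw_poly: "\<And>\<omega>. \<omega> \<in> \<Omega> \<Longrightarrow> polyhedron (Bw \<omega>) \<and> bounded (Bw \<omega>)"
    and Bw_pos: "\<And>\<omega>. \<omega> \<in> \<Omega> \<Longrightarrow> Bw \<omega> \<subseteq> UNIV \<times> {0<..}"
    and Bw_disj: "\<And>\<omega> \<omega>'. \<omega> \<in> \<Omega> \<Longrightarrow> \<omega>' \<in> \<Omega> \<Longrightarrow> \<omega> \<noteq> \<omega>' \<Longrightarrow>
                    interior (Bw \<omega>) \<inter> interior (Bw \<omega>') = {}"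
    and cover: "B \<subseteq> (\<Union>\<omega>\<in>\<Omega>. Bw \<omega>)"
    \<comment> \<open>the breakpoints \<open>b (gray_num l \<omega>)\<close> and \<open>b (gray_num l \<omega> + 1)\<close> below exist\<close>
    and index: "\<And>\<omega>. \<omega> \<in> \<Omega> \<Longrightarrow> gray_num l \<omega> + 1 \<le> card \<Omega>"
    and ext_ratios: "\<And>\<omega>. \<omega> \<in> \<Omega> \<Longrightarrow>
                    ratios (ext_pts (Bw \<omega>)) = {b (gray_num l \<omega>), b (gray_num l \<omega> + 1)}"
  shows "proj_ratio (logE l B \<Omega> Bw \<psi>) \<subseteq> step_set (ratios B) (card \<Omega>) b \<phi>"
proof
  fix p assume "p \<in> proj_ratio (logE l B \<Omega> Bw \<psi>)"
  then obtain y z f \<delta> lam where p: "p = (y / z, f)"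
    and "(y, z, f, \<delta>, lam) \<in> logE l B \<Omega> Bw \<psi>"
    by (auto simp: proj_ratio_def)
  moreover define V where "V = all_verts \<Omega> Bw"
  ultimately have yz: "(y, z) \<in> B" and \<delta>: "\<delta> \<in> \<Omega>" and lam: "lam \<in> V \<rightarrow>\<^sub>E {0..1}"
    and f: "f = (\<Sum>v\<in>V. lam v * \<psi> v)"
    and comb: "(y, z) = (\<Sum>v\<in>V. lam v *\<^sub>R v)"
    and total: "1 = (\<Sum>v\<in>V. lam v)"
    and zero: "\<And>k. k \<in> {1..l} \<Longrightarrow> 1 - real (\<delta> k) \<ge> (\<Sum>v\<in>verts_bit \<Omega> Bw k 0. lam v)"
    and one: "\<And>k. k \<in> {1..l} \<Longrightarrow> real (\<delta> k) \<ge> (\<Sum>v\<in>verts_bit \<Omega> Bw k 1. lam v)"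
    unfolding logE_def by auto
  define n where "n = card \<Omega>"
  define q where "q = gray_num l \<delta>"
  have q: "q + 1 \<le> n"
    using index[OF \<delta>] by (simp add: q_def n_def)
  have b_eq: "i = j" if "b i = b j" "i \<le> n" "j \<le> n" for i j
    using inj_onD[OF strict_mono_on_imp_inj_on[OF b_incr] that(1)] that(2,3)
    by (simp add: n_def)
  have b_mono: "b i \<le> b j" if "i \<le> j" "j \<le> n" for i j
    using strict_mono_on_leD[OF b_incr, of i j] that by (simp add: n_def)
  have b_T: "b i \<in> T" if "i \<le> n" for i
    using T_sup(2) that by (auto simp: n_def)
  have phi_b: "\<phi> (b i) \<le> \<phi> (b j)" if "i \<le> j" "j \<le> n" for i j
    using that b_T b_mono by (intro mono_onD[OF phi_incr]) auto
  \<comment> \<open>A sum over an infinite set has the value 0 instead of 1.\<close>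
  have fin: "finite V"
    using sum.infinite[of V lam] total by (cases "finite V") simp_all
  have nonneg: "0 \<le> lam v" if "v \<in> V" for v
    using lam that by fastforce
  have ratio: "fst v / snd v \<in> {b (gray_num l \<omega>), b (gray_num l \<omega> + 1)}"
    if "\<omega> \<in> \<Omega>" "v \<in> ext_pts (Bw \<omega>)" for v \<omega>
    using ext_ratios[OF that(1)] that(2) unfolding ratios_def by (cases v) auto
  have pos: "snd v > 0" if "v \<in> V" for v
    using that Bw_pos unfolding V_def all_verts_def ext_pts_def extreme_point_of_def by fastforce
  have support: "fst v / snd v \<in> {b q, b (q + 1)}" if v: "v \<in> V" "lam v \<noteq> 0" for v
  proof -
    define W where "W = {\<omega> \<in> \<Omega>. v \<in> ext_pts (Bw \<omega>)}"
    obtain \<omega>0 where \<omega>0: "\<omega>0 \<in> W"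
      using v(1) by (auto simp: W_def V_def all_verts_def)
    then obtain j where j: "j \<le> n" "fst v / snd v = b j"
      using ratio[of \<omega>0 v] index[of \<omega>0] unfolding W_def n_def
      by (metis (no_types, lifting) add_leD1 insertE mem_Collect_eq singletonD)
    have "\<delta> \<in> W"
    proof (rule bitwise_choice_gray)
      show "W \<subseteq> bin_vecs l" "W \<noteq> {}" "\<delta> \<in> bin_vecs l"
        using Omega(1) \<delta> \<omega>0 by (auto simp: W_def)
      show "gray_num l \<omega> = j \<or> gray_num l \<omega> + 1 = j" if "\<omega> \<in> W" for \<omega>
      proof -
        have "gray_num l \<omega> + 1 \<le> n" "b j \<in> {b (gray_num l \<omega>), b (gray_num l \<omega> + 1)}"
          using that index[of \<omega>] ratio[of \<omega> v] j(2) by (auto simp: W_def n_def)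
        then show ?thesis
          using b_eq[of j "gray_num l \<omega>"] b_eq[of j "gray_num l \<omega> + 1"] j(1) by auto
      qed
      show "\<exists>\<omega>\<in>W. \<omega> k = \<delta> k" if k: "k \<in> {1..l}" for k
      proof -
        have "\<omega> k < 2" if "\<omega> \<in> insert \<delta> \<Omega>" for \<omega>
          using that \<delta> Omega(1) k bin_vecs_less_2 by blast
        then show ?thesis
          using support_shares_bits[of \<Omega> Bw lam k \<delta> v] fin nonneg zero one k v
          unfolding V_def W_def by blast
      qed
    qed
    then show ?thesis
      using ratio[of \<delta> v] by (simp add: W_def q_def)
  qed
  have "b q * z \<le> y"
  proof -
    have "y = (\<Sum>v\<in>V. lam v * fst v)" "z = (\<Sum>v\<in>V. lam v * snd v)"
      using arg_cong[OF comb, of fst] arg_cong[OF comb, of snd]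
      by (simp_all add: fst_sum snd_sum)
    moreover have "b q * (lam v * snd v) \<le> lam v * fst v" if "v \<in> V" for v
    proof (cases "lam v = 0")
      case False
      then have "b q \<le> fst v / snd v"
        using support[OF that] b_mono[of q "q + 1"] q by auto
      then have "b q * snd v \<le> fst v"
        using pos[OF that] by (simp add: pos_le_divide_eq)
      from mult_left_mono[OF this nonneg[OF that]] show ?thesis
        by (simp add: algebra_simps)
    qed simp
    ultimately show ?thesis
      by (simp add: sum_distrib_left sum_mono)
  qed
  moreover have "z > 0"
    using yz B_pos by auto
  ultimately have lower: "b q \<le> y / z"
    by (simp add: pos_le_divide_eq)
  have upper: "f \<le> \<phi> (b (q + 1))"
  proof -
    have "lam v * \<psi> v \<le> lam v * \<phi> (b (q + 1))" if v: "v \<in> V" for v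
    proof (cases "lam v = 0")
      case False
      then have r: "fst v / snd v \<in> {b q, b (q + 1)}"
        using support v by blast
      then have "\<psi> v = \<phi> (fst v / snd v)"
        using psi[of "snd v" "fst v"] pos[OF v] b_T[of q] b_T[of "q + 1"] q by auto
      then have "\<psi> v \<le> \<phi> (b (q + 1))"
        using r phi_b[of q "q + 1"] q by auto
      then show ?thesis
        using nonneg[OF v] by (rule mult_left_mono)
    qed simp
    then have "f \<le> (\<Sum>v\<in>V. lam v * \<phi> (b (q + 1)))"
      unfolding f by (rule sum_mono)
    then show ?thesis
      using total[symmetric] by (simp flip: sum_distrib_right)
  qed
  have "f \<le> \<phi> (b k)" if "k \<in> {1..n}" "y / z < b k" for k
  proof -
    have "q + 1 \<le> k"
    proof (rule ccontr)
      assume "\<not> q + 1 \<le> k"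
      then have "b k \<le> b q"
        using b_mono[of k q] q by simp
      with lower that(2) show False by simp
    qed
    then show ?thesis
      using upper phi_b[of "q + 1" k] that(1) by fastforce
  qed
  moreover have "y / z \<in> ratios B"
    using yz by (auto simp: ratios_def)
  ultimately show "p \<in> step_set (ratios B) (card \<Omega>) b \<phi>"
    by (auto simp: step_set_def p n_def)
qed

end
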